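(* Let $f,g:\{0,1\}^n\to\{0,1\}$ be Boolean functions. (1) If $f$ and $g$ are unbalanced and $f$ is PN-equivalent to $g$, then $OSDV(f)=OSDV(g)$, $OSDV^0(f)=OSDV^0(g)$ and $OSDV^1(f)=OSDV^1(g)$. (2) If $f$ and $g$ are balanced and $f$ is NPN-equivalent to $g$, then either ($OSDV^1(f)=OSDV^1(g)$ and $OSDV^0(f)=OSDV^0(g)$) or ($OSDV^1(f)=OSDV^0(g)$ and $OSDV^0(f)=OSDV^1(g)$).
   Context: For a word $X=(x_1,\dots,x_n)\in\{0,1\}^n$, $X^i$ denotes $X$ with its $i$-th bit negated. A selective negation $(\neg)$ is a map $\{0,1\}^n\to\{0,1\}^n$ that negates the bits in some fixed set of positions and leaves the others unchanged. A permutation $\pi$ acts on words by reordering their entries. $f$ is PN-equivalent to $g$ if there are a permutation $\pi$ and a selective negation $(\neg)$ with $f(\pi((\neg)X))=g(X)$ for all $X\in\{0,1\}^n$. $f$ is NPN-equivalent to $g$ if there are $\pi$ and $(\neg)$ such that either $f(\pi((\neg)X))=g(X)$ for all $X$, or $\neg f(\pi((\neg)X))=g(X)$ for all $X$. A function $f$ on $n$ variables is balanced if $|f^{-1}(1)|=|f^{-1}(0)|=2^{n-1}$, and unbalanced otherwise. The local sensitivity of $f$ at $X$ is $sen(f,X)=|\{i\in\{1,\dots,n\}: f(X)\neq f(X^i)\}|$. $h(X,Y)$ is the Hamming distance between the words $X$ and $Y$. The ordered sensitivity distance vector is $OSDV(f)=(\sigma_0,\sigma_1,\dots,\sigma_n)$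 with $\sigma_i=(\delta_{i1},\dots,\delta_{in})$ and $$\delta_{ij}=|\{(X,Y)\in\{0,1\}^n\times\{0,1\}^n : sen(f,X)=sen(f,Y)=i,\ h(X,Y)=j,\ X<Y\}|,$$ where $X<Y$ compares words as binary integers (so each unordered pair is counted once). For $b\in\{0,1\}$, $OSDV^b(f)$ is defined in the same way, but counting only pairs $(X,Y)$ with $f(X)=f(Y)=b$. *)

theory Defs
  imports Complex_Main "HOL-Combinatorics.Permutations"
begin

text \<open>
  A word of length \<open>n\<close> is a Boolean list of length \<open>n\<close>; positions run over \<open>0, \<dots>, n - 1\<close>, so the
  \<open>i\<close>-th bit of the usual 1-based numbering is \<open>X ! (i - 1)\<close>. A Boolean function on \<open>n\<close> variables
  is given by a function on \<open>bool list\<close> of which only the values on \<open>words n\<close> are ever used.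
\<close>

definition words :: "nat \<Rightarrow> bool list set" where
  "words n = {X. length X = n}"

definition flip_at :: "nat \<Rightarrow> bool list \<Rightarrow> bool list" where
  "flip_at i X = X[i := \<not> X ! i]"

definition selective_neg :: "nat set \<Rightarrow> bool list \<Rightarrow> bool list" where
  "selective_neg S X = map (\<lambda>i. if i \<in> S then \<not> X ! i else X ! i) [0..<length X]"

definition PN_equivalent :: "nat \<Rightarrow> (bool list \<Rightarrow> bool) \<Rightarrow> (bool list \<Rightarrow> bool) \<Rightarrow> bool" where
  "PN_equivalent n f g \<longleftrightarrow>
     (\<exists>\<pi> S. \<pi> permutes {..<n} \<and> S \<subseteq> {..<n} \<and>
        (\<forall>X\<in>words n. f (permute_list \<pi> (selective_neg S X)) = g X))"

definition NPN_equivalent :: "nat \<Rightarrow> (bool list \<Rightarrow> bool) \<Rightarrow> (bool list \<Rightarrow> bool) \<Rightarrow> bool" where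
  "NPN_equivalent n f g \<longleftrightarrow>
     (\<exists>\<pi> S. \<pi> permutes {..<n} \<and> S \<subseteq> {..<n} \<and>
        ((\<forall>X\<in>words n. f (permute_list \<pi> (selective_neg S X)) = g X) \<or>
         (\<forall>X\<in>words n. (\<not> f (permute_list \<pi> (selective_neg S X))) = g X)))"

text \<open>
  For \<open>n = 0\<close> the truncated exponent makes no difference: the single word lies in only one of the
  two preimages, so no function is balanced.
\<close>

definition balanced :: "nat \<Rightarrow> (bool list \<Rightarrow> bool) \<Rightarrow> bool" where
  "balanced n f \<longleftrightarrow>
     card {X \<in> words n. f X} = 2 ^ (n - 1) \<and> card {X \<in> words n. \<not> f X} = 2 ^ (n - 1)"

definition sen :: "(bool list \<Rightarrow> bool) \<Rightarrow> bool list \<Rightarrow> nat" where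
  "sen f X = card {i. i < length X \<and> f X \<noteq> f (flip_at i X)}"

text \<open>Only meaningful for words of equal length.\<close>

definition hamming :: "bool list \<Rightarrow> bool list \<Rightarrow> nat" where
  "hamming X Y = card {i. i < length X \<and> X ! i \<noteq> Y ! i}"

text \<open>The first entry of a word is its most significant bit; \<open>horner_sum\<close> starts with the least one.\<close>

definition word_val :: "bool list \<Rightarrow> nat" where
  "word_val X = horner_sum of_bool 2 (rev X)"

definition delta :: "nat \<Rightarrow> (bool list \<Rightarrow> bool) \<Rightarrow> nat \<Rightarrow> nat \<Rightarrow> nat" where
  "delta n f i j = card {(X, Y). X \<in> words n \<and> Y \<in> words n \<and>
     sen f X = i \<and> sen f Y = i \<and> hamming X Y = j \<and> word_val X < word_val Y}"

definition delta_at :: "bool \<Rightarrow> nat \<Rightarrow> (bool list \<Rightarrow> bool) \<Rightarrow> nat \<Rightarrow> nat \<Rightarrow> nat" where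
  "delta_at b n f i j = card {(X, Y). X \<in> words n \<and> Y \<in> words n \<and> f X = b \<and> f Y = b \<and>
     sen f X = i \<and> sen f Y = i \<and> hamming X Y = j \<and> word_val X < word_val Y}"

definition OSDV :: "nat \<Rightarrow> (bool list \<Rightarrow> bool) \<Rightarrow> nat list list" where
  "OSDV n f = map (\<lambda>i. map (\<lambda>j. delta n f i j) [1..<n+1]) [0..<n+1]"

definition OSDV_at :: "bool \<Rightarrow> nat \<Rightarrow> (bool list \<Rightarrow> bool) \<Rightarrow> nat list list" where
  "OSDV_at b n f = map (\<lambda>i. map (\<lambda>j. delta_at b n f i j) [1..<n+1]) [0..<n+1]"

end

theory Submission
  imports Defs
begin

text \<open>
  Permuting and selectively negating coordinates is a Hamming isometry \<open>T\<close> of the cube. The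
  sensitivity of \<open>f\<close> at \<open>X\<close> only depends on the values of \<open>f\<close> at the points at distance 1 from
  \<open>X\<close>, so \<open>T\<close> carries the points of sensitivity \<open>i\<close> of \<open>f \<circ> T\<close> to those of \<open>f\<close>. The order on words
  merely selects one representative of each unordered pair, hence the number of pairs at distance
  \<open>j\<close> in a set of words is an isometry invariant as well. Negating \<open>f\<close> leaves the sensitivities
  unchanged and swaps the two preimages.
\<close>

definition isometry :: "nat \<Rightarrow> (bool list \<Rightarrow> bool list) \<Rightarrow> bool" where
  "isometry n T \<longleftrightarrow> T ` words n \<subseteq> words n \<and>
     (\<forall>X\<in>words n. \<forall>Y\<in>words n. hamming (T X) (T Y) = hamming X Y)"

definition pair_count :: "bool list set \<Rightarrow> nat \<Rightarrow> nat" where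
  "pair_count A j =
     card {(X, Y). X \<in> A \<and> Y \<in> A \<and> hamming X Y = j \<and> word_val X < word_val Y}"

section \<open>Words, their numerical order, and pairs at a given distance\<close>

lemma finite_words: "finite (words n)"
  using finite_lists_length_eq[of "UNIV :: bool set" n] by (simp add: words_def)

lemma hamming_commute: "length X = length Y \<Longrightarrow> hamming X Y = hamming Y X"
  unfolding hamming_def by (auto intro: arg_cong[where f = card])

lemma hamming_eq_0_iff: "length X = length Y \<Longrightarrow> hamming X Y = 0 \<longleftrightarrow> X = Y"
  by (auto simp: hamming_def list_eq_iff_nth_eq)

lemma horner_sum_of_bool_2_inj:
  assumes "length xs = length ys"
    and "horner_sum of_bool (2 :: nat) xs = horner_sum of_bool 2 ys"
  shows "xs = ys"
  using assms
proof (induction xs ys rule: list_induct2)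
  case (Cons x xs y ys)
  \<comment> \<open>Parity recovers the head, since the tail enters with factor 2.\<close>
  have "even (horner_sum of_bool (2 :: nat) (x # xs)) \<longleftrightarrow> even (horner_sum of_bool (2 :: nat) (y # ys))"
    by (simp only: Cons.prems)
  then have "x = y"
    by (cases x; cases y) simp_all
  with Cons show ?case
    by simp
qed simp

text \<open>This makes comparison by \<open>word_val\<close> a strict total order on words of one
  length, so every pair of distinct words is ordered in exactly one way.\<close>

lemma word_val_eq_iff: "length X = length Y \<Longrightarrow> word_val X = word_val Y \<longleftrightarrow> X = Y"
  unfolding word_val_def using horner_sum_of_bool_2_inj[of "rev X" "rev Y"] by auto

text \<open>An isometry need not respect the order of words, so the count is tied to one that does
  not mention the order: the increasing pairs and their mirror images partition the pairs of
  distinct words.\<close>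

lemma card_ordered_pairs:
  assumes "A \<subseteq> words n"
  shows "card {(X, Y). X \<in> A \<and> Y \<in> A \<and> hamming X Y = j \<and> X \<noteq> Y} = 2 * pair_count A j"
proof -
  define L where "L = {(X, Y). X \<in> A \<and> Y \<in> A \<and> hamming X Y = j \<and> word_val X < word_val Y}"
  have len: "length X = length Y" if "X \<in> A" "Y \<in> A" for X Y
    using assms that by (auto simp: words_def)
  have "finite A"
    using assms finite_words finite_subset by blast
  then have "finite L"
    by (rule_tac finite_subset[of _ "A \<times> A"]) (auto simp: L_def)
  have swap: "prod.swap ` L =
      {(X, Y). X \<in> A \<and> Y \<in> A \<and> hamming Y X = j \<and> word_val Y < word_val X}"
    by (auto simp: L_def)
  have neq: "X \<noteq> Y \<longleftrightarrow> word_val X < word_val Y \<or> word_val Y < word_val X"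
    and ham: "hamming Y X = hamming X Y" if "X \<in> A" "Y \<in> A" for X Y
    using len[OF that] word_val_eq_iff[of X Y] hamming_commute[of X Y] by auto
  have "{(X, Y). X \<in> A \<and> Y \<in> A \<and> hamming X Y = j \<and> X \<noteq> Y} = L \<union> prod.swap ` L"
    unfolding swap L_def using neq ham by auto
  moreover have "L \<inter> prod.swap ` L = {}"
    by (auto simp: L_def)
  moreover have "card (prod.swap ` L) = card L"
    by (simp add: card_image)
  ultimately show ?thesis
    using \<open>finite L\<close> by (simp add: card_Un_disjoint pair_count_def L_def)
qed

text \<open>Words with equal images are at distance 0, hence equal; on the finite set
  \<open>words n\<close> injectivity then forces surjectivity.\<close>

lemma isometry_bij_betw:
  assumes "isometry n T"
  shows "bij_betw T (words n) (words n)"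
proof -
  have "inj_on T (words n)"
  proof (rule inj_onI)
    fix X Y assume *: "X \<in> words n" "Y \<in> words n" "T X = T Y"
    then have "hamming X Y = hamming (T X) (T X)"
      using assms unfolding isometry_def by metis
    also have "\<dots> = 0"
      by (simp add: hamming_eq_0_iff)
    finally show "X = Y"
      using * by (simp add: hamming_eq_0_iff words_def)
  qed
  then show ?thesis
    using assms finite_words endo_inj_surj[of "words n" T]
    by (auto simp: bij_betw_def isometry_def)
qed

lemma pair_count_isometry:
  assumes T: "isometry n T" and A: "A \<subseteq> words n" and TA: "T ` A = B"
  shows "pair_count A j = pair_count B j"
proof -
  have B: "B \<subseteq> words n" and inj: "inj_on T A"
    using assms isometry_bij_betw[OF T] inj_on_subset[of T "words n" A]
    by (auto simp: bij_betw_def)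
  have ham: "hamming (T X) (T Y) = hamming X Y" if "X \<in> A" "Y \<in> A" for X Y
    using T A that by (auto simp: isometry_def)
  \<comment> \<open>\<open>T\<close> may reverse the order within a pair, so the bijection is set up
    between pairs of distinct words; the common factor 2 cancels at the end.\<close>
  have "bij_betw (map_prod T T) {(X, Y). X \<in> A \<and> Y \<in> A \<and> hamming X Y = j \<and> X \<noteq> Y}
          {(X, Y). X \<in> B \<and> Y \<in> B \<and> hamming X Y = j \<and> X \<noteq> Y}"
    unfolding bij_betw_def
  proof
    show "inj_on (map_prod T T) {(X, Y). X \<in> A \<and> Y \<in> A \<and> hamming X Y = j \<and> X \<noteq> Y}"
      using inj by (auto simp: inj_on_def)
    show "map_prod T T ` {(X, Y). X \<in> A \<and> Y \<in> A \<and> hamming X Y = j \<and> X \<noteq> Y} =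
          {(X, Y). X \<in> B \<and> Y \<in> B \<and> hamming X Y = j \<and> X \<noteq> Y}"
    proof (intro equalityI subsetI)
      fix p assume "p \<in> {(X, Y). X \<in> B \<and> Y \<in> B \<and> hamming X Y = j \<and> X \<noteq> Y}"
      then obtain X Y where "p = map_prod T T (X, Y)" "X \<in> A" "Y \<in> A"
          "hamming (T X) (T Y) = j" "T X \<noteq> T Y"
        unfolding TA[symmetric] by auto
      then show "p \<in> map_prod T T ` {(X, Y). X \<in> A \<and> Y \<in> A \<and> hamming X Y = j \<and> X \<noteq> Y}"
        using ham by (intro image_eqI) auto
    qed (use inj ham TA in \<open>auto dest: inj_onD\<close>)
  qed
  then show ?thesis
    using card_ordered_pairs[OF A, of j] card_ordered_pairs[OF B, of j]
    by (auto dest!: bij_betw_same_card)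
qed

section \<open>Sensitivity as a metric notion\<close>

lemma flip_at_inj_on: "inj_on (\<lambda>i. flip_at i X) {..<length X}"
proof (rule inj_onI)
  fix i k assume "i \<in> {..<length X}" "k \<in> {..<length X}" "flip_at i X = flip_at k X"
  \<comment> \<open>Bit \<open>i\<close> separates the two flips: the first negates it, the second
    keeps it unless \<open>k = i\<close>.\<close>
  then have "flip_at i X ! i = flip_at k X ! i" and "i < length X" by simp_all
  then show "i = k"
    by (cases "i = k") (auto simp: flip_at_def)
qed

lemma hamming_flip_at:
  assumes "i < length X" shows "hamming X (flip_at i X) = 1"
proof -
  have "{k. k < length X \<and> X ! k \<noteq> flip_at i X ! k} = {i}"
    using assms by (auto simp: flip_at_def nth_list_update)
  then show ?thesis by (simp add: hamming_def)
qed

lemma hamming_1_flip_at: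
  assumes "length Y = length X" and "hamming X Y = 1"
  obtains i where "i < length X" and "Y = flip_at i X"
proof -
  obtain i where i: "{k. k < length X \<and> X ! k \<noteq> Y ! k} = {i}"
    using assms(2) by (auto simp: hamming_def card_1_singleton_iff)
  then have "i < length X" by auto
  moreover have "Y ! k = flip_at i X ! k" if "k < length X" for k
  proof -
    have "X ! k \<noteq> Y ! k \<longleftrightarrow> k = i"
      using i that by blast
    with that show ?thesis
      by (auto simp: flip_at_def nth_list_update)
  qed
  then have "Y = flip_at i X"
    using assms(1) by (intro nth_equalityI) (simp_all add: flip_at_def)
  ultimately show ?thesis by (rule that)
qed

text \<open>The flips of \<open>X\<close> are exactly its neighbours, without repetition. Counting
  neighbours instead of positions removes the coordinates, leaving only distances, which isometries
  preserve.\<close>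

lemma sen_eq_card_neighbours:
  assumes "X \<in> words n"
  shows "sen f X = card {Y \<in> words n. hamming X Y = 1 \<and> f X \<noteq> f Y}"
proof -
  have "{Y \<in> words n. hamming X Y = 1 \<and> f X \<noteq> f Y} =
        (\<lambda>i. flip_at i X) ` {i. i < length X \<and> f X \<noteq> f (flip_at i X)}"
  proof (intro equalityI subsetI)
    fix Y assume Y: "Y \<in> {Y \<in> words n. hamming X Y = 1 \<and> f X \<noteq> f Y}"
    then obtain i where "i < length X" "Y = flip_at i X"
      using assms hamming_1_flip_at[of Y X] by (auto simp: words_def)
    with Y show "Y \<in> (\<lambda>i. flip_at i X) ` {i. i < length X \<and> f X \<noteq> f (flip_at i X)}"
      by auto
  next
    fix Y assume "Y \<in> (\<lambda>i. flip_at i X) ` {i. i < length X \<and> f X \<noteq> f (flip_at i X)}"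
    then show "Y \<in> {Y \<in> words n. hamming X Y = 1 \<and> f X \<noteq> f Y}"
      using assms hamming_flip_at by (auto simp: words_def) (simp_all add: flip_at_def)
  qed
  moreover have "inj_on (\<lambda>i. flip_at i X) {i. i < length X \<and> f X \<noteq> f (flip_at i X)}"
    using flip_at_inj_on by (rule inj_on_subset) auto
  ultimately show ?thesis
    by (simp add: sen_def card_image)
qed

text \<open>\<open>T\<close> maps the neighbours of \<open>X\<close> onto those of
  \<open>T X\<close>. The hypothesis only compares whether values differ, so it covers both f
  \<circ> T = g and its negated version.\<close>

lemma sen_isometry:
  assumes T: "isometry n T"
    and fg: "\<And>X Y. X \<in> words n \<Longrightarrow> Y \<in> words n \<Longrightarrow> f (T X) \<noteq> f (T Y) \<longleftrightarrow> g X \<noteq> g Y"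
    and X: "X \<in> words n"
  shows "sen f (T X) = sen g X"
proof -
  have bij: "bij_betw T (words n) (words n)"
    using T by (rule isometry_bij_betw)
  then have TX: "T X \<in> words n"
    using X by (auto simp: bij_betw_def)
  have im: "{Y \<in> words n. hamming (T X) Y = 1 \<and> f (T X) \<noteq> f Y} =
        T ` {Y \<in> words n. hamming X Y = 1 \<and> g X \<noteq> g Y}"
  proof (intro equalityI subsetI)
    fix Z assume Z: "Z \<in> {Y \<in> words n. hamming (T X) Y = 1 \<and> f (T X) \<noteq> f Y}"
    then obtain Y where "Y \<in> words n" "Z = T Y"
      using bij by (auto simp: bij_betw_def)
    with Z show "Z \<in> T ` {Y \<in> words n. hamming X Y = 1 \<and> g X \<noteq> g Y}"
      using T X fg[of X Y] by (auto simp: isometry_def)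
  next
    fix Z assume "Z \<in> T ` {Y \<in> words n. hamming X Y = 1 \<and> g X \<noteq> g Y}"
    then obtain Y where "Y \<in> words n" "Z = T Y" "hamming X Y = 1" "g X \<noteq> g Y"
      by blast
    then show "Z \<in> {Y \<in> words n. hamming (T X) Y = 1 \<and> f (T X) \<noteq> f Y}"
      using T X fg[of X Y] by (auto simp: isometry_def)
  qed
  have "inj_on T {Y \<in> words n. hamming X Y = 1 \<and> g X \<noteq> g Y}"
    using bij by (auto simp: bij_betw_def intro: inj_on_subset)
  then show ?thesis
    unfolding sen_eq_card_neighbours[OF TX] sen_eq_card_neighbours[OF X] im by (rule card_image)
qed

section \<open>Invariance of the distance vectors\<close>

lemma delta_eq_pair_count: "delta n f i j = pair_count {X \<in> words n. sen f X = i} j"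
  unfolding delta_def pair_count_def by (rule arg_cong[where f = card]) auto

lemma delta_at_eq_pair_count:
  "delta_at b n f i j = pair_count {X \<in> words n. f X = b \<and> sen f X = i} j"
  unfolding delta_at_def pair_count_def by (rule arg_cong[where f = card]) auto

lemma isometry_image_Collect:
  assumes "isometry n T" and "\<And>X. X \<in> words n \<Longrightarrow> P (T X) \<longleftrightarrow> Q X"
  shows "T ` {X \<in> words n. Q X} = {X \<in> words n. P X}"
  using isometry_bij_betw[OF assms(1)] assms(2) by (fastforce simp: bij_betw_def)

lemma OSDV_isometry:
  assumes T: "isometry n T" and fg: "\<And>X. X \<in> words n \<Longrightarrow> f (T X) = g X"
  shows "OSDV n f = OSDV n g"
proof -
  have sen: "sen f (T X) = sen g X" if "X \<in> words n" for X
    using that fg by (intro sen_isometry[OF T]) auto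
  \<comment> \<open>The equation runs from \<open>g\<close> to \<open>f\<close> because
    \<open>T\<close> maps the level sets of \<open>g\<close> onto those of \<open>f\<close>.\<close>
  have "delta n g i j = delta n f i j" for i j
    unfolding delta_eq_pair_count
    using sen
    by (intro pair_count_isometry[OF T] isometry_image_Collect[OF T]) auto
  then show ?thesis by (simp add: OSDV_def)
qed

text \<open>The bit \<open>c\<close> records whether the output is kept (\<open>True\<close>) or
  negated (\<open>False\<close>). Accordingly \<open>f (T X) = b\<close> holds iff
  \<open>g X = (b = c)\<close>, which says which preimage of \<open>g\<close> corresponds to that of
  \<open>b\<close> under \<open>f\<close>.\<close>

lemma OSDV_at_isometry:
  assumes T: "isometry n T" and fg: "\<And>X. X \<in> words n \<Longrightarrow> f (T X) = (g X = c)"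
  shows "OSDV_at b n f = OSDV_at (b = c) n g"
proof -
  have sen: "sen f (T X) = sen g X" if "X \<in> words n" for X
    using that fg by (intro sen_isometry[OF T]) auto
  have "delta_at (b = c) n g i j = delta_at b n f i j" for i j
    unfolding delta_at_eq_pair_count
    using sen fg
    by (intro pair_count_isometry[OF T] isometry_image_Collect[OF T]) auto
  then show ?thesis by (simp add: OSDV_at_def)
qed

text \<open>Negating the same position in both words does not change whether they differ there, and
  a permutation merely relabels the positions where they differ.\<close>

lemma isometry_permute_selective_neg:
  assumes \<pi>: "\<pi> permutes {..<n}"
  shows "isometry n (\<lambda>X. permute_list \<pi> (selective_neg S X))"
  unfolding isometry_def
proof (intro conjI ballI)
  show "(\<lambda>X. permute_list \<pi> (selective_neg S X)) ` words n \<subseteq> words n"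
    by (auto simp: words_def selective_neg_def)
next
  fix X Y assume X: "X \<in> words n" and Y: "Y \<in> words n"
  \<comment> \<open>On Booleans \<open>\<noteq>\<close> is exclusive or, so this covers negated and
    unnegated positions at once.\<close>
  have nth: "permute_list \<pi> (selective_neg S Z) ! i = (Z ! \<pi> i \<noteq> (\<pi> i \<in> S))"
    if "Z \<in> words n" "i < n" for Z i
    using that \<pi> permutes_in_image[OF \<pi>, of i]
    by (auto simp: permute_list_nth selective_neg_def words_def)
  \<comment> \<open>Position \<open>i\<close> of the image reads position \<open>\<pi> i\<close>, so
    \<open>\<pi>\<close> sends differing positions of the images to those of \<open>X\<close> and
    \<open>Y\<close>.\<close>
  have "bij_betw \<pi> {i. i < n \<and> X ! \<pi> i \<noteq> Y ! \<pi> i} {i. i < n \<and> X ! i \<noteq> Y ! i}"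
    unfolding bij_betw_def
  proof
    show "inj_on \<pi> {i. i < n \<and> X ! \<pi> i \<noteq> Y ! \<pi> i}"
      using permutes_inj_on[OF \<pi>] .
    show "\<pi> ` {i. i < n \<and> X ! \<pi> i \<noteq> Y ! \<pi> i} = {i. i < n \<and> X ! i \<noteq> Y ! i}"
    proof (intro equalityI subsetI)
      fix k assume k: "k \<in> {i. i < n \<and> X ! i \<noteq> Y ! i}"
      then obtain i where "i < n" "k = \<pi> i"
        using permutes_image[OF \<pi>] by blast
      with k show "k \<in> \<pi> ` {i. i < n \<and> X ! \<pi> i \<noteq> Y ! \<pi> i}"
        by blast
    qed (use permutes_in_image[OF \<pi>] in auto)
  qed
  moreover have "{i. i < n \<and> permute_list \<pi> (selective_neg S X) ! i \<noteq>
                             permute_list \<pi> (selective_neg S Y) ! i} =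
                 {i. i < n \<and> X ! \<pi> i \<noteq> Y ! \<pi> i}"
    using nth[OF X] nth[OF Y] by auto
  ultimately show "hamming (permute_list \<pi> (selective_neg S X)) (permute_list \<pi> (selective_neg S Y))
      = hamming X Y"
    using X by (auto simp: hamming_def words_def selective_neg_def dest: bij_betw_same_card)
qed

theorem theorem4:
  fixes n :: nat and f g :: "bool list \<Rightarrow> bool"
  shows "(\<not> balanced n f \<and> \<not> balanced n g \<and> PN_equivalent n f g \<longrightarrow>
            OSDV n f = OSDV n g \<and>
            OSDV_at False n f = OSDV_at False n g \<and>
            OSDV_at True n f = OSDV_at True n g) \<and>
         (balanced n f \<and> balanced n g \<and> NPN_equivalent n f g \<longrightarrow>
            (OSDV_at True n f = OSDV_at True n g \<and> OSDV_at False n f = OSDV_at False n g) \<or>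
            (OSDV_at True n f = OSDV_at False n g \<and> OSDV_at False n f = OSDV_at True n g))"
proof (intro conjI impI, goal_cases)
  case PN: 1
  then obtain \<pi> S where \<pi>: "\<pi> permutes {..<n}"
    and fg: "\<And>X. X \<in> words n \<Longrightarrow> f (permute_list \<pi> (selective_neg S X)) = g X"
    unfolding PN_equivalent_def by blast
  show ?case
    using OSDV_isometry[OF isometry_permute_selective_neg[OF \<pi>, of S], of f g] fg by simp
next
  case PN: 2
  then obtain \<pi> S where \<pi>: "\<pi> permutes {..<n}"
    and fg: "\<And>X. X \<in> words n \<Longrightarrow> f (permute_list \<pi> (selective_neg S X)) = g X"
    unfolding PN_equivalent_def by blast
  \<comment> \<open>Here \<open>c = True\<close> and \<open>b = False\<close>; as
    \<open>False = True\<close> is \<open>False\<close>, each preimage is matched with the one of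
    the same value.\<close>
  show ?case
    using OSDV_at_isometry[OF isometry_permute_selective_neg[OF \<pi>, of S], of f g True False] fg
    by simp
next
  case PN: 3
  then obtain \<pi> S where \<pi>: "\<pi> permutes {..<n}"
    and fg: "\<And>X. X \<in> words n \<Longrightarrow> f (permute_list \<pi> (selective_neg S X)) = g X"
    unfolding PN_equivalent_def by blast
  show ?case
    using OSDV_at_isometry[OF isometry_permute_selective_neg[OF \<pi>, of S], of f g True True] fg
    by simp
next
  case NPN: 4
  \<comment> \<open>The bit \<open>c\<close> merges the two alternatives of NPN-equivalence.\<close>
  then obtain \<pi> S c where \<pi>: "\<pi> permutes {..<n}"
    and fg: "\<And>X. X \<in> words n \<Longrightarrow> f (permute_list \<pi> (selective_neg S X)) = (g X = c)"
    unfolding NPN_equivalent_def by (metis (full_types))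
  have "OSDV_at b n f = OSDV_at (b = c) n g" for b
    using OSDV_at_isometry[OF isometry_permute_selective_neg[OF \<pi>, of S], of f g c b] fg by simp
  \<comment> \<open>\<open>c = True\<close> gives the first disjunct; \<open>c = False\<close> gives
    the one with the two preimages swapped.\<close>
  from this[of True] this[of False] show ?case
    by (cases c) simp_all
qed

end
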